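(* Let $T=(K,L,R)$ and let $(b_T(n))_{n\in\mathbb N_0}$ be any sequence associated with $T$. Let $h\in\mathbb N$ be coprime to $r=\sum_{j=0}^{u}r_j$ and satisfy $2\le h\le \underline{\deg}\,K-u+1$. Then at least one of the following holds: (1) all but finitely many values $b_T(n)$ are divisible by $h$; (2) all but finitely many values $b_T(n)$ are not coprime to $h$, and (1) does not hold; (3) for every integer sequence $(d_T(n))_{n\in\mathbb N_0}$ such that $$d_T(k_n+s)-d_T(k_n+s-1)=l_0b_T(k_{k_n+s})+l_1b_T(k_{k_n+s-1})+\dots+l_tb_T(k_{k_n+s-t})$$ for all $n\in\mathbb N_0$ and $s\in\{0,\dots,k_{n+1}-k_n-1\}$ with $k_n+s\ge1$, every residue class modulo $h$ appears infinitely many times in $(d_T(n)\bmod h)_{n\in\mathbb N_0}$. Moreover, the only two of these conditions that can hold simultaneously are (2) and (3).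
   Context: Let $K=(k_n)_{n\in\mathbb N_0}$ be a strictly increasing sequence of non-negative integers with $k_0=0$; set $k_{-n}=-n$ for $n\in\mathbb N$. Let $L=(l_0,\dots,l_t)$ and $R=(r_0,\dots,r_u)$ be finite sequences of integers and $T=(K,L,R)$. A sequence of integers $(b_T(n))_{n\in\mathbb N_0}$, extended by $b_T(q)=0$ for negative integers $q$, is associated with $T$ if for every $n\in\mathbb N_0$: (a) $b_T(k_n)=b_T(k_n+1)=\dots=b_T(k_{n+1}-1)$, and (b) $\sum_{i=0}^{t}l_ib_T(k_{n-i})=\sum_{j=0}^{u}r_jb_T(n-j)$ (initial values are otherwise arbitrary). The lower degree of $K$ is $\underline{\deg}\,K=\inf\{d\in\mathbb N:\ k_n-k_{n-1}=d \text{ for infinitely many } n\}$. *)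

theory Defs
  imports Complex_Main "HOL-Library.Extended_Nat"
begin

text \<open>A triple \<open>T = (K, L, R)\<close>. The finite sequences \<open>(l\<^sub>0, \<dots>, l\<^sub>t)\<close> and \<open>(r\<^sub>0, \<dots>, r\<^sub>u)\<close> are
  nonempty lists, so that \<open>t = length L - 1\<close> and \<open>u = length R - 1\<close>.\<close>

definition valid_triple :: "(nat \<Rightarrow> nat) \<Rightarrow> int list \<Rightarrow> int list \<Rightarrow> bool" where
  "valid_triple K L R \<longleftrightarrow> strict_mono K \<and> K 0 = 0 \<and> L \<noteq> [] \<and> R \<noteq> []"

text \<open>Extensions to negative indices: \<open>k\<^sub>q = q\<close> and \<open>b(q) = 0\<close> for \<open>q < 0\<close>.\<close>

definition k_ext :: "(nat \<Rightarrow> nat) \<Rightarrow> int \<Rightarrow> int" where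
  "k_ext K q = (if q \<ge> 0 then int (K (nat q)) else q)"

definition zero_ext :: "(nat \<Rightarrow> int) \<Rightarrow> int \<Rightarrow> int" where
  "zero_ext b q = (if q \<ge> 0 then b (nat q) else 0)"

definition associated :: "(nat \<Rightarrow> nat) \<Rightarrow> int list \<Rightarrow> int list \<Rightarrow> (nat \<Rightarrow> int) \<Rightarrow> bool" where
  "associated K L R b \<longleftrightarrow>
     (\<forall>n. (\<forall>m\<in>{K n..<K (Suc n)}. b m = b (K n)) \<and>
          (\<Sum>i<length L. L ! i * zero_ext b (k_ext K (int n - int i))) =
          (\<Sum>j<length R. R ! j * zero_ext b (int n - int j)))"

text \<open>The infimum is taken in the extended naturals: it is \<open>\<infinity>\<close> if no gap occurs infinitely often.
  Only the gaps of the original sequence (nonnegative indices) count.\<close>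

definition lower_degree :: "(nat \<Rightarrow> nat) \<Rightarrow> enat" where
  "lower_degree K = Inf (enat ` {d. d \<ge> 1 \<and> infinite {n. n \<ge> 1 \<and> K n - K (n - 1) = d}})"

text \<open>The bound \<open>h \<le> lower_degree K - u + 1\<close> with \<open>u = length R - 1\<close> is rearranged because
  subtraction truncates on \<^typ>\<open>enat\<close>.\<close>

definition admissible_modulus :: "(nat \<Rightarrow> nat) \<Rightarrow> int list \<Rightarrow> nat \<Rightarrow> bool" where
  "admissible_modulus K R h \<longleftrightarrow>
     coprime (int h) (sum_list R) \<and> 2 \<le> h \<and>
     enat h + enat (length R - 1) \<le> lower_degree K + 1"

definition almost_all_divisible :: "(nat \<Rightarrow> int) \<Rightarrow> nat \<Rightarrow> bool" where
  "almost_all_divisible b h \<longleftrightarrow> finite {n. \<not> int h dvd b n}"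

definition almost_all_not_coprime :: "(nat \<Rightarrow> int) \<Rightarrow> nat \<Rightarrow> bool" where
  "almost_all_not_coprime b h \<longleftrightarrow>
     finite {n. coprime (b n) (int h)} \<and> \<not> almost_all_divisible b h"

definition difference_sequence ::
    "(nat \<Rightarrow> nat) \<Rightarrow> int list \<Rightarrow> (nat \<Rightarrow> int) \<Rightarrow> (nat \<Rightarrow> int) \<Rightarrow> bool" where
  "difference_sequence K L b d \<longleftrightarrow>
     (\<forall>n s. s < K (Suc n) - K n \<and> K n + s \<ge> 1 \<longrightarrow>
        d (K n + s) - d (K n + s - 1) =
        (\<Sum>i<length L. L ! i * zero_ext b (k_ext K (int (K n + s) - int i))))"

definition all_residues_infinitely_often ::
    "(nat \<Rightarrow> nat) \<Rightarrow> int list \<Rightarrow> (nat \<Rightarrow> int) \<Rightarrow> nat \<Rightarrow> bool" where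
  "all_residues_infinitely_often K L b h \<longleftrightarrow>
     (\<forall>d. difference_sequence K L b d \<longrightarrow>
        (\<forall>a\<in>{0..<int h}. infinite {n. d n mod int h = a}))"

end

theory Submission
  imports Defs "HOL-Number_Theory.Cong"
begin

text \<open>
  By condition (b), a difference sequence satisfies \<open>d(m) - d(m-1) = \<Sum>\<^sub>j r\<^sub>j b(m-j)\<close>. Since \<open>b\<close> is
  constant on a block, past the first \<open>u\<close> indices of the block \<open>d\<close> runs through an arithmetic
  progression with step \<open>r b(k\<^sub>n)\<close>. All but finitely many blocks are long enough for at least \<open>h\<close>
  terms, so a block with \<open>b(k\<^sub>n)\<close> coprime to \<open>h\<close> meets every residue class.

  For the coexistence of (2) and (3), take \<open>k\<^sub>n = 8n\<close>, \<open>h = 6\<close>, \<open>R = (1)\<close>. Then \<open>L\<close> with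
  \<open>L(z) \<equiv> 1 + z (mod 2)\<close> and \<open>L(z) \<equiv> (1 + z\<^sup>2)(1 + 2z + 2z\<^sup>2) (mod 3)\<close> divides \<open>1 + z + \<dots> + z\<^sup>7\<close>
  modulo 2 and 3, with quotients \<open>1 + z\<^sup>2 + z\<^sup>4 + z\<^sup>6\<close> and \<open>1 + 2z + 2z\<^sup>3\<close> sharing only the constant
  term. So modulo 6 the values \<open>c(n) = b(8n)\<close> are products of the weights \<open>1,2,3,2,3,0,3,0\<close> of the
  octal digits of \<open>n\<close>, and no \<open>c(n)\<close> with \<open>n > 0\<close> is coprime to 6. A block with \<open>c(m) \<equiv> 3\<close> reaches
  both parities, while the partial sums of \<open>c\<close> before such blocks run through all classes modulo 3.
\<close>

section \<open>Blocks and the recurrence satisfied by difference sequences\<close>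

lemma block_exists:
  fixes K :: "nat \<Rightarrow> nat"
  assumes "strict_mono K" "K 0 = 0"
  shows "\<exists>n. K n \<le> m \<and> m < K (Suc n)"
proof (induction m)
  case 0
  then show ?case
    using assms strict_monoD[of K 0 "Suc 0"] by (intro exI[of _ 0]) auto
next
  case (Suc m)
  then obtain n where n: "K n \<le> m" "m < K (Suc n)"
    by blast
  show ?case
  proof (cases "Suc m < K (Suc n)")
    case True
    then show ?thesis using n by (intro exI[of _ n]) auto
  next
    case False
    then have "K (Suc n) = Suc m" using n by simp
    then show ?thesis
      using strict_monoD[OF assms(1), of "Suc n" "Suc (Suc n)"] by (intro exI[of _ "Suc n"]) auto
  qed
qed

lemma sum_nth_mult_right:
  fixes R :: "int list"
  shows "(\<Sum>j<length R. R ! j * x) = sum_list R * x"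
  unfolding sum_list_sum_nth sum_distrib_right atLeast0LessThan by (rule refl)

text \<open>The blocks cover all indices, so the pairs \<open>n\<close>, \<open>s\<close> reach
  every \<open>m\<close> \<ge> 1, and condition (b) turns the sum over \<open>L\<close> into the sum
  over \<open>R\<close>. From here on only the values of \<open>b\<close> at \<open>m\<close> and
  shortly before it matter.\<close>

lemma difference_sequence_iff:
  assumes "valid_triple K L R" "associated K L R b"
  shows "difference_sequence K L b d \<longleftrightarrow>
    (\<forall>m\<ge>1. d m - d (m - 1) = (\<Sum>j<length R. R ! j * zero_ext b (int m - int j)))"
proof
  assume *: "difference_sequence K L b d"
  show "\<forall>m\<ge>1. d m - d (m - 1) = (\<Sum>j<length R. R ! j * zero_ext b (int m - int j))"
  proof (intro allI impI)
    fix m :: nat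
    assume m: "1 \<le> m"
    obtain n where n: "K n \<le> m" "m < K (Suc n)"
      using block_exists assms(1) by (metis valid_triple_def)
    have "m - K n < K (Suc n) - K n \<and> K n + (m - K n) \<ge> 1"
      using m n by auto
    then have "d m - d (m - 1) = (\<Sum>i<length L. L ! i * zero_ext b (k_ext K (int m - int i)))"
      using *[unfolded difference_sequence_def, rule_format, where n = n and s = "m - K n"]
      unfolding le_add_diff_inverse[OF n(1)] by blast
    then show "d m - d (m - 1) = (\<Sum>j<length R. R ! j * zero_ext b (int m - int j))"
      using assms(2) by (simp add: associated_def)
  qed
next
  assume *: "\<forall>m\<ge>1. d m - d (m - 1) = (\<Sum>j<length R. R ! j * zero_ext b (int m - int j))"
  show "difference_sequence K L b d"
    unfolding difference_sequence_def
  proof (intro allI impI)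
    fix n s
    assume "s < K (Suc n) - K n \<and> 1 \<le> K n + s"
    then have "d (K n + s) - d (K n + s - 1) =
        (\<Sum>j<length R. R ! j * zero_ext b (int (K n + s) - int j))"
      using * by blast
    then show "d (K n + s) - d (K n + s - 1) =
        (\<Sum>i<length L. L ! i * zero_ext b (k_ext K (int (K n + s) - int i)))"
      using assms(2) by (simp only: associated_def)
  qed
qed

text \<open>Condition (3) quantifies over all difference sequences; existence of one keeps it from
  being vacuous when it has to be refuted.\<close>

lemma difference_sequence_exists:
  assumes "valid_triple K L R" "associated K L R b"
  shows "\<exists>d. difference_sequence K L b d"
proof
  let ?f = "\<lambda>m. \<Sum>j<length R. R ! j * zero_ext b (int m - int j)"
  show "difference_sequence K L b (\<lambda>n. \<Sum>m=1..n. ?f m)"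
    unfolding difference_sequence_iff[OF assms]
  proof (intro allI impI)
    fix m :: nat
    assume "1 \<le> m"
    then obtain k where "m = Suc k" by (cases m) auto
    then show "(\<Sum>m=1..m. ?f m) - (\<Sum>m=1..m - 1. ?f m) = ?f m" by simp
  qed
qed

section \<open>Long blocks and the arithmetic progressions on them\<close>

text \<open>A positive gap that recurs infinitely often is at least the infimum
  \<open>lower_degree K\<close>, so each gap value \<open>d\<close> with \<open>d + 1 < x\<close>
  occurs finitely often, and there are finitely many such values.\<close>

lemma finite_small_gaps:
  assumes "strict_mono K" "enat x \<le> lower_degree K + 1"
  shows "finite {n. K (Suc n) - K n + 1 < x}"
proof -
  have fin: "finite {n. K (Suc n) - K n = d}" if "d + 1 < x" for d
  \<comment> \<open>The infimum ranges over \<open>d\<close> \<ge> 1 only; gap 0 is excluded by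
    strict monotonicity instead.\<close>
  proof (cases "d = 0")
    case True
    then have "{n. K (Suc n) - K n = d} = {}"
      using assms(1) by (auto simp: strict_mono_Suc_iff not_le)
    then show ?thesis by simp
  next
    case False
    have "finite {n. n \<ge> 1 \<and> K n - K (n - 1) = d}"
    proof (rule ccontr)
      assume "infinite {n. n \<ge> 1 \<and> K n - K (n - 1) = d}"
      then have "lower_degree K \<le> enat d"
        unfolding lower_degree_def using False by (intro Inf_lower) auto
      then have "lower_degree K + 1 \<le> enat d + 1" by (rule add_right_mono)
      with assms(2) have "enat x \<le> enat d + 1" by (rule order_trans)
      then show False using that by (simp add: one_enat_def)
    qed
    moreover have "Suc ` {n. K (Suc n) - K n = d} \<subseteq> {n. n \<ge> 1 \<and> K n - K (n - 1) = d}"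
      by auto
    ultimately have "finite (Suc ` {n. K (Suc n) - K n = d})"
      using finite_subset by blast
    then show ?thesis by (rule finite_imageD) simp
  qed
  have sub: "{n. K (Suc n) - K n + 1 < x} \<subseteq> (\<Union>d\<in>{d. d + 1 < x}. {n. K (Suc n) - K n = d})"
    by auto
  have "finite {d. d + 1 < x}"
    by (rule finite_subset[of _ "{..<x}"]) auto
  then have "finite (\<Union>d\<in>{d. d + 1 < x}. {n. K (Suc n) - K n = d})"
    by (rule finite_UN_I) (rule fin, simp)
  with sub show ?thesis
    by (rule finite_subset)
qed

lemma arith_progression_hits_residue:
  fixes x q a :: int
  assumes "coprime q (int h)" "a \<in> {0..<int h}"
  shows "\<exists>k<h. (x + int k * q) mod int h = a"
proof -
  obtain y where y: "[q * y = 1] (mod int h)"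
    using cong_solve_coprime_int assms(1) by blast
  have h: "int h > 0" using assms(2) by auto
  \<comment> \<open>Solves \<open>x + k * q = a\<close> modulo \<open>h\<close> with the inverse
    \<open>y\<close> of \<open>q\<close>.\<close>
  define k where "k = nat (((a - x) * y) mod int h)"
  have k: "int k = ((a - x) * y) mod int h" "k < h"
    using h by (auto simp: k_def nat_less_iff)
  have "[x + int k * q = x + (a - x) * y * q] (mod int h)"
    unfolding k(1) by (intro cong_add cong_mult) (auto simp: cong_def)
  also have "x + (a - x) * y * q = x + (a - x) * (q * y)" by simp
  also have "[\<dots> = x + (a - x) * 1] (mod int h)"
    using y by (intro cong_add cong_mult) auto
  finally show ?thesis
    using k(2) assms(2) by (auto simp: cong_def intro!: exI[of _ k])
qed

text \<open>With u = \<open>length R - 1\<close>, all of \<open>n\<close>, ..., \<open>n - u\<close>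
  lie in block \<open>m\<close> once \<open>n\<close> is at least \<open>K m + u\<close>, so each
  increment is r times the block value. The progression starts one index earlier, at
  \<open>K m + u - 1\<close>, which gains a term and accounts for the +1 in the bound on h. Since
  \<open>m\<close> \<ge> 1, that subtraction does not truncate.\<close>

lemma difference_sequence_block:
  assumes "valid_triple K L R" "associated K L R b" "difference_sequence K L b d"
    and "m \<ge> 1" "length R - 1 + k \<le> K (Suc m) - K m"
  shows "d (K m + (length R - 1) - 1 + k) =
    d (K m + (length R - 1) - 1) + int k * (sum_list R * b (K m))"
  using assms(5)
proof (induction k)
  case (Suc k)
  have "K m \<ge> 1"
    using assms(1,4) strict_monoD[of K 0 m] by (auto simp: valid_triple_def)
  then obtain n where n: "K m + (length R - 1) - 1 + Suc k = n" "n = K m + (length R - 1) + k"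
      "n - 1 = K m + (length R - 1) - 1 + k" "n \<ge> 1"
    by auto
  have "zero_ext b (int n - int j) = b (K m)" if "j < length R" for j
  proof -
    have j: "int n - int j = int (n - j)" using that n by auto
    have "n - j \<in> {K m..<K (Suc m)}"
      using that n(2) Suc.prems by auto
    then have "b (n - j) = b (K m)"
      using assms(2) unfolding associated_def by blast
    then show ?thesis unfolding j by (simp add: zero_ext_def)
  qed
  then have "d n - d (n - 1) = sum_list R * b (K m)"
    using assms(3) n(4) sum_nth_mult_right[of R "b (K m)"]
    unfolding difference_sequence_iff[OF assms(1,2)] by simp
  moreover have "d (n - 1) = d (K m + (length R - 1) - 1) + int k * (sum_list R * b (K m))"
    unfolding n(3) by (rule Suc.IH) (use Suc.prems in simp)
  ultimately show ?case unfolding n(1) by (simp add: algebra_simps)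
qed simp

lemma coprime_infinitely_often_imp_all_residues:
  assumes "valid_triple K L R" "associated K L R b" "admissible_modulus K R h"
    and inf: "infinite {n. coprime (b n) (int h)}"
  shows "all_residues_infinitely_often K L b h"
  unfolding all_residues_infinitely_often_def
proof (intro allI impI ballI)
  fix d a
  assume d: "difference_sequence K L b d" and a: "a \<in> {0..<int h}"
  have K: "strict_mono K" "K 0 = 0" using assms(1) by (auto simp: valid_triple_def)
  define u where "u = length R - 1"
  define M where "M = {m. coprime (b (K m)) (int h)}"
  \<comment> \<open>Blocks are finite, so infinitely many coprime values need infinitely many
    blocks; discarding the short ones leaves infinitely many.\<close>
  have "{n. coprime (b n) (int h)} \<subseteq> (\<Union>m\<in>M. {K m..<K (Suc m)})"
  proof
    fix n
    assume n: "n \<in> {n. coprime (b n) (int h)}"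
    obtain m where m: "K m \<le> n" "n < K (Suc m)" using block_exists[OF K] by blast
    then have "b n = b (K m)" using assms(2) by (auto simp: associated_def)
    then have "m \<in> M" using n by (simp add: M_def)
    then show "n \<in> (\<Union>m\<in>M. {K m..<K (Suc m)})" using m by auto
  qed
  then have "infinite M" using inf by (meson finite_UN_I finite_atLeastLessThan finite_subset)
  moreover have "finite {n. K (Suc n) - K n + 1 < h + u}"
    using assms(3) finite_small_gaps[OF K(1)]
    by (auto simp: admissible_modulus_def u_def plus_enat_simps)
  ultimately have inf': "infinite (M - {n. K (Suc n) - K n + 1 < h + u})" by simp
  show "infinite {n. d n mod int h = a}"
    unfolding infinite_nat_iff_unbounded_le
  proof
    fix N
    obtain m where m: "m > N" "coprime (b (K m)) (int h)" "K (Suc m) - K m + 1 \<ge> h + u"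
      using inf' unfolding infinite_nat_iff_unbounded M_def
      by (metis (mono_tags, lifting) Diff_iff mem_Collect_eq not_less)
    have "coprime (sum_list R * b (K m)) (int h)"
      using m(2) assms(3) by (simp add: admissible_modulus_def coprime_commute)
    then obtain k where k: "k < h"
      "(d (K m + u - 1) + int k * (sum_list R * b (K m))) mod int h = a"
      using arith_progression_hits_residue a by blast
    \<comment> \<open>From \<open>k < h\<close> and a gap of at least \<open>h + u - 1\<close>, the
      index stays inside block \<open>m\<close>.\<close>
    have "d (K m + u - 1 + k) mod int h = a"
      using difference_sequence_block[OF assms(1,2) d, of m k] m(1,3) k by (simp add: u_def)
    moreover have "N \<le> K m + u - 1 + k"
      using m(1) strict_mono_imp_increasing[OF K(1), of m] by simp
    ultimately show "\<exists>n\<ge>N. n \<in> {n. d n mod int h = a}" by blast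
  qed
qed

section \<open>Incompatibility of (1) and (3)\<close>

text \<open>Eventually all increments of \<open>d\<close> vanish modulo \<open>h\<close>, so
  \<open>d\<close> is eventually constant modulo \<open>h\<close> and misses a class because
  \<open>h\<close> \<ge> 2.\<close>

lemma almost_all_divisible_imp_not_all_residues:
  assumes "valid_triple K L R" "associated K L R b" "2 \<le> h" "almost_all_divisible b h"
  shows "\<not> all_residues_infinitely_often K L b h"
proof
  assume all: "all_residues_infinitely_often K L b h"
  obtain d where d: "difference_sequence K L b d"
    using difference_sequence_exists[OF assms(1,2)] by blast
  obtain N where "\<And>n. \<not> int h dvd b n \<Longrightarrow> n < N"
    using assms(4) unfolding almost_all_divisible_def finite_nat_set_iff_bounded by blast
  then have N: "\<And>n. n \<ge> N \<Longrightarrow> int h dvd b n"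
    by (meson not_less)
  define M where "M = N + length R"
  have inc: "int h dvd d n - d (n - 1)" if "n > M" for n
  proof -
    have "int h dvd zero_ext b (int n - int j)" if "j < length R" for j
      using N[of "n - j"] that \<open>n > M\<close> by (auto simp: zero_ext_def M_def nat_diff_distrib)
    then have "int h dvd (\<Sum>j<length R. R ! j * zero_ext b (int n - int j))"
      by (intro dvd_sum) auto
    then show ?thesis
      using d that unfolding difference_sequence_iff[OF assms(1,2)] by simp
  qed
  have const: "d n mod int h = d M mod int h" if "n \<ge> M" for n
    using that
  proof (induction n rule: dec_induct)
    case (step n)
    then show ?case using inc[of "Suc n"]
      by (simp add: mod_eq_dvd_iff[symmetric])
  qed simp
  obtain a where a: "a \<in> {0..<int h}" "a \<noteq> d M mod int h"
  proof (cases "d M mod int h = 0")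
    case True
    then show ?thesis using assms(3) by (intro that[of 1]) auto
  next
    case False
    then show ?thesis using assms(3) by (intro that[of 0]) auto
  qed
  have "{n. d n mod int h = a} \<subseteq> {..<M}"
  proof
    fix n assume "n \<in> {n. d n mod int h = a}"
    then have "\<not> n \<ge> M" using const[of n] a(2) by blast
    then show "n \<in> {..<M}" by simp
  qed
  then have "finite {n. d n mod int h = a}" using finite_subset by blast
  then show False using all d a(1) by (auto simp: all_residues_infinitely_often_def)
qed

section \<open>The octal example: coexistence of (2) and (3) modulo 6\<close>

text \<open>Condition (b) for k_n = 8n, L = (1,5,0,2,2), R = (1), solved for the leading term; the
  guards realise the zero extension. At \<open>n = 0\<close> the condition is a tautology, so the
  value 1 is a free choice.\<close>

fun octal_seq :: "nat \<Rightarrow> int" where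
  "octal_seq n = (if n = 0 then 1 else octal_seq (n div 8) - 5 * octal_seq (n - 1)
     - (if n \<ge> 3 then 2 * octal_seq (n - 3) else 0)
     - (if n \<ge> 4 then 2 * octal_seq (n - 4) else 0))"

declare octal_seq.simps [simp del]

lemma octal_seq_rec:
  "n \<ge> 4 \<Longrightarrow> octal_seq n =
    octal_seq (n div 8) - 5 * octal_seq (n - 1) - 2 * octal_seq (n - 3) - 2 * octal_seq (n - 4)"
  by (subst octal_seq.simps) simp

lemma octal_seq_initial:
  "octal_seq 0 = 1" "octal_seq 1 = -4" "octal_seq 2 = 21" "octal_seq 3 = -106" "octal_seq 4 = 537"
proof -
  show 0: "octal_seq 0 = 1" by (simp add: octal_seq.simps)
  show 1: "octal_seq 1 = -4" by (subst octal_seq.simps) (simp add: 0)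
  show 2: "octal_seq 2 = 21" using 1 by (subst octal_seq.simps) (simp add: 0)
  show 3: "octal_seq 3 = -106" by (subst octal_seq.simps) (simp add: 0 2)
  show "octal_seq 4 = 537" using 1 by (subst octal_seq.simps) (simp add: 0 3)
qed

text \<open>The factors are the coefficients of the quotient of 1 + z + ... + z^7 by L(z) modulo 6.
  The recurrence looks back four places, so the induction step needs only the last four entries of
  the previous block.\<close>

lemma octal_seq_block:
  "6 dvd octal_seq (8 * m) - octal_seq m \<and> 6 dvd octal_seq (8 * m + 1) - 2 * octal_seq m \<and>
   6 dvd octal_seq (8 * m + 2) - 3 * octal_seq m \<and> 6 dvd octal_seq (8 * m + 3) - 2 * octal_seq m \<and>
   6 dvd octal_seq (8 * m + 4) - 3 * octal_seq m \<and> 6 dvd octal_seq (8 * m + 5) \<and>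
   6 dvd octal_seq (8 * m + 6) - 3 * octal_seq m \<and> 6 dvd octal_seq (8 * m + 7)"
proof (induction m)
  case 0
  have 5: "octal_seq 5 = octal_seq 0 - 5 * octal_seq 4 - 2 * octal_seq 2 - 2 * octal_seq 1"
    by (subst octal_seq.simps) simp
  have 6: "octal_seq 6 = octal_seq 0 - 5 * octal_seq 5 - 2 * octal_seq 3 - 2 * octal_seq 2"
    by (subst octal_seq.simps) simp
  have 7: "octal_seq 7 = octal_seq 0 - 5 * octal_seq 6 - 2 * octal_seq 4 - 2 * octal_seq 3"
    by (subst octal_seq.simps) simp
  show ?case
    unfolding mult_0_right add_0 using octal_seq_initial 5 6 7 by simp
next
  case (Suc m)
  define c where "c = octal_seq (Suc m)"
  define f where "f i = octal_seq (8 * m + i)" for i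
  have rec: "f i = c - 5 * f (i - 1) - 2 * f (i - 3) - 2 * f (i - 4)" if "i \<in> {8..15}" for i
  proof -
    have "i div 8 = 1" using that by auto
    then show ?thesis using octal_seq_rec[of "8 * m + i"] that by (simp add: f_def c_def)
  qed
  obtain p q r s where old: "f 4 = 3 * octal_seq m + 6 * p" "f 5 = 6 * q"
      "f 6 = 3 * octal_seq m + 6 * r" "f 7 = 6 * s"
    using Suc unfolding f_def dvd_def by (metis add.commute diff_add_cancel)
  \<comment> \<open>The \<open>k\<close> values collect the multiples of 6. The old value
    \<open>octal_seq m\<close> has factor 3 in \<open>f 4\<close> and \<open>f 6\<close>, which
    enter the recurrence only with coefficient 2, so it disappears modulo 6.\<close>
  define k8 where "k8 = -5 * s - 2 * q - octal_seq m - 2 * p"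
  define k9 where "k9 = -c - 5 * k8 - octal_seq m - 2 * r - 2 * q"
  define k10 where "k10 = -2 * c - 5 * k9 - 2 * s - octal_seq m - 2 * r"
  define k11 where "k11 = -3 * c - 5 * k10 - 2 * k8 - 2 * s"
  define k12 where "k12 = -3 * c - 5 * k11 - 2 * k9 - 2 * k8"
  define k13 where "k13 = -4 * c - 5 * k12 - 2 * k10 - 2 * k9"
  define k14 where "k14 = -2 * c - 5 * k13 - 2 * k11 - 2 * k10"
  define k15 where "k15 = -4 * c - 5 * k14 - 2 * k12 - 2 * k11"
  have f8: "f 8 = c + 6 * k8" using rec[of 8] old by (simp add: k8_def)
  have f9: "f 9 = 2 * c + 6 * k9" using rec[of 9] old f8 by (simp add: k9_def)
  have f10: "f 10 = 3 * c + 6 * k10" using rec[of 10] old f9 by (simp add: k10_def)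
  have f11: "f 11 = 2 * c + 6 * k11" using rec[of 11] old f8 f10 by (simp add: k11_def)
  have f12: "f 12 = 3 * c + 6 * k12" using rec[of 12] f8 f9 f11 by (simp add: k12_def)
  have f13: "f 13 = 6 * k13" using rec[of 13] f9 f10 f12 by (simp add: k13_def)
  have f14: "f 14 = 3 * c + 6 * k14" using rec[of 14] f10 f11 f13 by (simp add: k14_def)
  have f15: "f 15 = 6 * k15" using rec[of 15] f11 f12 f14 by (simp add: k15_def)
  have shift: "octal_seq (8 * Suc m + i) = f (8 + i)" for i
    by (simp add: f_def add.assoc add.left_commute)
  show ?case
    unfolding shift shift[of 0, unfolded add_0_right] c_def[symmetric]
    using f8 f9 f10 f11 f12 f13 f14 f15 by simp
qed

text \<open>Every nonzero last octal digit contributes a weight 2, 3 or 0, none coprime to 6. A last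
  digit 0 has weight 1 and allows descent to \<open>n div 8\<close>, which is still
  positive.\<close>

lemma octal_seq_not_coprime:
  assumes "n \<ge> 1"
  shows "even (octal_seq n) \<or> 3 dvd octal_seq n"
  using assms
proof (induction n rule: less_induct)
  case (less n)
  have n: "n = 8 * (n div 8) + n mod 8" by simp
  have *: "even (octal_seq (n div 8)) \<or> 3 dvd octal_seq (n div 8) \<or> n mod 8 \<noteq> 0"
    using less.IH[of "n div 8"] less.prems n by (cases "n div 8 = 0") auto
  have dvd: "even x \<or> 3 dvd x" if "6 dvd x - w * y" "even w \<or> 3 dvd w \<or> even y \<or> 3 dvd y"
    for w x y :: int
  proof -
    have "2 dvd x - w * y" "3 dvd x - w * y"
      using dvd_trans[OF _ that(1), of 2] dvd_trans[OF _ that(1), of 3] by simp_all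
    moreover have "2 dvd w * y \<or> 3 dvd w * y" using that(2) by auto
    ultimately show ?thesis
      using dvd_add[of 2 "x - w * y" "w * y"] dvd_add[of 3 "x - w * y" "w * y"]
      unfolding diff_add_cancel by blast
  qed
  have "n mod 8 \<in> {0,1,2,3,4,5,6,7}" by auto
  then show ?case
  proof (elim insertE)
    assume "n mod 8 = 0"
    then show ?thesis
      using dvd[of "octal_seq n" 1 "octal_seq (n div 8)"] octal_seq_block[of "n div 8"] * n by auto
  next
    assume "n mod 8 = 1"
    then show ?thesis
      using dvd[of "octal_seq n" 2 "octal_seq (n div 8)"] octal_seq_block[of "n div 8"] n by auto
  next
    assume "n mod 8 = 2"
    then show ?thesis
      using dvd[of "octal_seq n" 3 "octal_seq (n div 8)"] octal_seq_block[of "n div 8"] n by auto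
  next
    assume "n mod 8 = 3"
    then show ?thesis
      using dvd[of "octal_seq n" 2 "octal_seq (n div 8)"] octal_seq_block[of "n div 8"] n by auto
  next
    assume "n mod 8 = 4"
    then show ?thesis
      using dvd[of "octal_seq n" 3 "octal_seq (n div 8)"] octal_seq_block[of "n div 8"] n by auto
  next
    assume "n mod 8 = 5"
    then show ?thesis
      using dvd[of "octal_seq n" 0 "octal_seq (n div 8)"] octal_seq_block[of "n div 8"] n by auto
  next
    assume "n mod 8 = 6"
    then show ?thesis
      using dvd[of "octal_seq n" 3 "octal_seq (n div 8)"] octal_seq_block[of "n div 8"] n by auto
  next
    assume "n mod 8 = 7"
    then show ?thesis
      using dvd[of "octal_seq n" 0 "octal_seq (n div 8)"] octal_seq_block[of "n div 8"] n by auto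
  qed simp
qed

text \<open>The eight weights add up to 14, which is 2 modulo 3.\<close>

lemma octal_seq_sum_block:
  "3 dvd (\<Sum>i<8 * m. octal_seq i) - 2 * (\<Sum>i<m. octal_seq i)"
proof (induction m)
  case (Suc m)
  have "(\<Sum>i<8 * Suc m. octal_seq i) =
    (\<Sum>i<8 * m. octal_seq i) + octal_seq (8 * m) + octal_seq (8 * m + 1)
    + octal_seq (8 * m + 2) + octal_seq (8 * m + 3) + octal_seq (8 * m + 4) + octal_seq (8 * m + 5)
    + octal_seq (8 * m + 6) + octal_seq (8 * m + 7)"
    by (simp add: eval_nat_numeral)
  also have "3 dvd \<dots> - 2 * (\<Sum>i<Suc m. octal_seq i)"
  proof -
    have aux: "3 dvd S + f0 + f1 + f2 + f3 + f4 + f5 + f6 + f7 - 2 * (s + c)"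
      if "3 dvd S - 2 * s" "6 dvd f0 - c" "6 dvd f1 - 2 * c" "6 dvd f2 - 3 * c" "6 dvd f3 - 2 * c"
        "6 dvd f4 - 3 * c" "6 dvd f5" "6 dvd f6 - 3 * c" "6 dvd f7"
      for S s c f0 f1 f2 f3 f4 f5 f6 f7 :: int
    proof -
      have "3 dvd f0 - c" "3 dvd f1 - 2 * c" "3 dvd f2 - 3 * c" "3 dvd f3 - 2 * c"
        "3 dvd f4 - 3 * c" "3 dvd f5" "3 dvd f6 - 3 * c" "3 dvd f7"
        using that by (auto elim: dvd_trans[rotated])
      then have "3 dvd (S - 2 * s) + (f0 - c) + (f1 - 2 * c) + (f2 - 3 * c) + (f3 - 2 * c)
          + (f4 - 3 * c) + f5 + (f6 - 3 * c) + f7 + 3 * (4 * c)"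
        using that(1) by (intro dvd_add) auto
      then show ?thesis by (simp add: algebra_simps)
    qed
    show ?thesis using aux[OF Suc] octal_seq_block[of m] by simp
  qed
  finally show ?case .
qed simp

lemma infinite_if_closed_under_scaling:
  fixes P :: "nat \<Rightarrow> bool"
  assumes "P m" "m > 0" "c > 1" "\<And>n. P n \<Longrightarrow> P (c * n)"
  shows "infinite {n. P n}"
proof
  assume fin: "finite {n. P n}"
  define n where "n = Max {n. P n}"
  have "P n" unfolding n_def using Max_in[OF fin] assms(1) by auto
  then have "c * n \<le> n" unfolding n_def using fin assms(4) by (intro Max_ge) auto
  moreover have "m \<le> n" unfolding n_def using fin assms(1) by (intro Max_ge) auto
  ultimately show False using assms(2,3) by auto
qed

text \<open>Passing from \<open>m\<close> to \<open>8 * m\<close> keeps \<open>octal_seq\<close>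
  modulo 6 and doubles the partial sum modulo 3. Passing to \<open>64 * m\<close> thus preserves
  both, and one positive witness per class suffices: 2, 32 and 4.\<close>

lemma octal_seq_residues:
  assumes "q \<in> {0,1,2}"
  shows "infinite {m. octal_seq m mod 6 = 3 \<and> (\<Sum>i<m. octal_seq i) mod 3 = q}"
proof -
  have scale: "octal_seq (8 * m) mod 6 = octal_seq m mod 6"
    "(\<Sum>i<8 * m. octal_seq i) mod 3 = 2 * (\<Sum>i<m. octal_seq i) mod 3" for m
    using octal_seq_block[of m] octal_seq_sum_block[of m] by (simp_all add: mod_eq_dvd_iff)
  have scale2: "octal_seq (64 * m) mod 6 = octal_seq m mod 6"
    "(\<Sum>i<64 * m. octal_seq i) mod 3 = (\<Sum>i<m. octal_seq i) mod 3" for m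
  proof -
    show "octal_seq (64 * m) mod 6 = octal_seq m mod 6"
      using scale(1)[of "8 * m"] scale(1)[of m] by simp
    have "(\<Sum>i<64 * m. octal_seq i) mod 3 = 2 * (\<Sum>i<8 * m. octal_seq i) mod 3"
      using scale(2)[of "8 * m"] by simp
    also have "\<dots> = 2 * (2 * (\<Sum>i<m. octal_seq i)) mod 3"
      using scale(2)[of m] by (metis mod_mult_right_eq)
    also have "\<dots> = (\<Sum>i<m. octal_seq i) mod 3" by presburger
    finally show "(\<Sum>i<64 * m. octal_seq i) mod 3 = (\<Sum>i<m. octal_seq i) mod 3" .
  qed
  have s2: "(\<Sum>i<2. octal_seq i) = -3" using octal_seq_initial by (simp add: eval_nat_numeral)
  have s4: "(\<Sum>i<4. octal_seq i) = -88" using octal_seq_initial by (simp add: eval_nat_numeral)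
  have "\<exists>m>0. octal_seq m mod 6 = 3 \<and> (\<Sum>i<m. octal_seq i) mod 3 = q"
    using assms
  proof (elim insertE)
    assume "q = 0"
    then show ?thesis using octal_seq_initial s2 by (intro exI[of _ 2]) simp
  next
    assume "q = 1"
    then show ?thesis using scale[of 4] octal_seq_initial s4 by (intro exI[of _ 32]) simp
  next
    assume "q = 2"
    then show ?thesis using octal_seq_initial s4 by (intro exI[of _ 4]) simp
  qed simp
  then obtain m where "octal_seq m mod 6 = 3 \<and> (\<Sum>i<m. octal_seq i) mod 3 = q" "m > 0" by blast
  then show ?thesis
    by (rule infinite_if_closed_under_scaling[where c = 64]) (auto simp: scale2)
qed

text \<open>Just before block \<open>m\<close> the value is \<open>e + 8 * A\<close>: its parity is
  that of \<open>e\<close>, while \<open>A\<close> governs it modulo 3. One further step of size 3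
  modulo 6 flips the parity and leaves the class modulo 3 unchanged.\<close>

lemma partial_sums_hit_residues:
  assumes d: "\<And>n. n \<ge> 1 \<Longrightarrow> d n - d (n - 1) = octal_seq (n div 8)"
    and a: "a \<in> {0..<6}"
  shows "infinite {n. d n mod 6 = a}"
proof -
  \<comment> \<open>The value obtained by extrapolating block 0 back to index -1; it absorbs the
    arbitrary \<open>d 0\<close>.\<close>
  define e where "e = d 7 - 8 * octal_seq 0"
  have block: "d (8 * m + 7) = e + 8 * (\<Sum>i<Suc m. octal_seq i)" for m
  proof (induction m)
    case 0
    then show ?case by (simp add: e_def)
  next
    case (Suc m)
    have s: "d (8 * m + 7 + k) = d (8 * m + 7) + int k * octal_seq (Suc m)" if "k \<le> 8" for k
      using that
    proof (induction k)
      case (Suc k)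
      have "(8 * m + 7 + Suc k) div 8 = Suc m" using Suc.prems by auto
      then show ?case using Suc d[of "8 * m + 7 + Suc k"] by (simp add: algebra_simps)
    qed simp
    have "d (8 * Suc m + 7) = d (8 * m + 7) + 8 * octal_seq (Suc m)"
      using s[of 8] by (simp add: algebra_simps)
    then show ?case using Suc by simp
  qed
  \<comment> \<open>As 8 is its own inverse modulo 3, this class of \<open>A\<close> makes
    \<open>e + 8 * A\<close> congruent to \<open>a\<close> modulo 3; \<open>\<epsilon>\<close> then
    corrects the parity.\<close>
  define q where "q = (2 * (a - e)) mod 3"
  define \<epsilon> :: nat where "\<epsilon> = (if even (a - e) then 0 else 1)"
  have "q \<in> {0,1,2}" unfolding q_def by auto
  note inf = octal_seq_residues[OF this]
  show ?thesis
    unfolding infinite_nat_iff_unbounded_le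
  proof
    fix N
    obtain m where m: "m > N" "octal_seq m mod 6 = 3" "(\<Sum>i<m. octal_seq i) mod 3 = q"
      using inf unfolding infinite_nat_iff_unbounded by auto
    obtain p where p: "m = Suc p" using m(1) by (cases m) auto
    define A where "A = (\<Sum>i<m. octal_seq i)"
    have "3 dvd A - 2 * (a - e)" using m(3) unfolding q_def A_def by (simp only: mod_eq_dvd_iff)
    then obtain v where "A - 2 * (a - e) = 3 * v" by (rule dvdE)
    then have v: "A = 2 * (a - e) + 3 * v" by simp
    have d0: "d (8 * m - 1) = e + 8 * A" using block[of p] by (simp add: p A_def add.commute)
    have d1: "d (8 * m) = d (8 * m - 1) + octal_seq m" using d[of "8 * m"] p by simp
    have "d (8 * m - 1 + \<epsilon>) mod 6 = a"
    proof (cases "even (a - e)")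
      case True
      then obtain t where "a - e = 2 * t" by blast
      then have "e = a - 2 * t" "A = 4 * t + 3 * v" using v by simp_all
      then have "e + 8 * A = a + 6 * (5 * t + 4 * v)" by simp
      then have "(e + 8 * A) mod 6 = a mod 6" by (simp only: mod_mult_self2)
      then show ?thesis using True a d0 by (simp add: \<epsilon>_def)
    next
      case False
      then obtain t where "a - e = 2 * t + 1" by (rule oddE)
      then have "e = a - 2 * t - 1" "A = 4 * t + 2 + 3 * v" using v by simp_all
      moreover obtain w where "octal_seq m = 6 * w + 3"
        using m(2) by (metis div_mult_mod_eq mult.commute)
      ultimately have "e + 8 * A + octal_seq m = a + 6 * (5 * t + 4 * v + w + 3)"
        by simp
      then have "(e + 8 * A + octal_seq m) mod 6 = a mod 6" by (simp only: mod_mult_self2)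
      then show ?thesis using False a d0 d1 p by (simp add: \<epsilon>_def)
    qed
    moreover have "N \<le> 8 * m - 1 + \<epsilon>" using m(1) by simp
    ultimately show "\<exists>n\<ge>N. n \<in> {n. d n mod 6 = a}" by blast
  qed
qed

lemma example_both:
  defines "K \<equiv> \<lambda>n::nat. 8 * n" and "L \<equiv> [1, 5, 0, 2, 2] :: int list"
    and "R \<equiv> [1] :: int list" and "b \<equiv> \<lambda>n. octal_seq (n div 8)"
  shows "valid_triple K L R" "associated K L R b" "admissible_modulus K R 6"
    "almost_all_not_coprime b 6" "all_residues_infinitely_often K L b 6"
proof -
  show valid: "valid_triple K L R"
    by (auto simp: valid_triple_def K_def L_def R_def strict_mono_def)
  have z: "zero_ext b (k_ext K (int n - int i)) = (if i \<le> n then octal_seq (n - i) else 0)" for n i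
  proof (cases "i \<le> n")
    case True
    then have i: "int n - int i = int (n - i)" by simp
    have "zero_ext b (k_ext K (int j)) = octal_seq j" for j
      by (simp only: zero_ext_def k_ext_def K_def b_def nat_int of_nat_0_le_iff if_True) simp
    then show ?thesis using True unfolding i by presburger
  qed (simp add: zero_ext_def k_ext_def)
  have sumL: "(\<Sum>i<length L. L ! i * zero_ext b (k_ext K (int n - int i))) = octal_seq (n div 8)" for n
  proof -
    have expand: "(\<Sum>i<length L. L ! i * g i) = g 0 + 5 * g 1 + 2 * g 3 + 2 * g 4" for g
      by (simp add: L_def eval_nat_numeral)
    have "(\<Sum>i<length L. L ! i * zero_ext b (k_ext K (int n - int i))) = octal_seq n
        + 5 * (if 1 \<le> n then octal_seq (n - 1) else 0)
        + 2 * (if 3 \<le> n then octal_seq (n - 3) else 0)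
        + 2 * (if 4 \<le> n then octal_seq (n - 4) else 0)"
      unfolding z expand by simp
    also have "\<dots> = octal_seq (n div 8)"
    proof (cases "n = 0")
      case False
      then have "octal_seq n = octal_seq (n div 8) - 5 * octal_seq (n - 1)
          - (if n \<ge> 3 then 2 * octal_seq (n - 3) else 0)
          - (if n \<ge> 4 then 2 * octal_seq (n - 4) else 0)"
        by (subst octal_seq.simps) (simp only: if_False)
      moreover have "1 \<le> n" using False by simp
      ultimately show ?thesis by (cases "3 \<le> n"; cases "4 \<le> n") simp_all
    qed simp
    finally show ?thesis .
  qed
  show assoc: "associated K L R b"
    unfolding associated_def sumL
    by (auto simp: R_def zero_ext_def b_def K_def intro!: arg_cong[of _ _ octal_seq])
  have gaps: "{n. n \<ge> 1 \<and> K n - K (n - 1) = d} = (if d = 8 then {1..} else {})" for d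
    by (auto simp: K_def)
  have "lower_degree K = 8"
    unfolding lower_degree_def gaps
    by (intro antisym Inf_lower Inf_greatest) (auto simp: numeral_eq_enat infinite_Ici split: if_splits)
  then show "admissible_modulus K R 6"
    by (simp add: admissible_modulus_def R_def numeral_eq_enat one_enat_def)
  have cop: "\<not> coprime (octal_seq n) 6" if "n \<ge> 1" for n
  proof -
    obtain p :: int where "p \<in> {2, 3}" "p dvd octal_seq n"
      using octal_seq_not_coprime[OF \<open>n \<ge> 1\<close>] by auto
    then show ?thesis using not_coprimeI[of p "octal_seq n" 6] by auto
  qed
  \<comment> \<open>Only block 0, with value 1, is coprime to 6.\<close>
  have "{n. coprime (b n) (int 6)} \<subseteq> {..<8}"
  proof
    fix n assume "n \<in> {n. coprime (b n) (int 6)}"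
    then have "\<not> n div 8 \<ge> 1" using cop[of "n div 8"] by (auto simp: b_def)
    then show "n \<in> {..<8}" by auto
  qed
  then have "finite {n. coprime (b n) (int 6)}" by (rule finite_subset) simp
  moreover have "\<not> almost_all_divisible b 6"
  proof
    assume "almost_all_divisible b 6"
    then have "finite {n. \<not> 6 dvd b n}" by (simp add: almost_all_divisible_def)
    \<comment> \<open>Values congruent to 3 modulo 6 recur infinitely often, so (1) fails.\<close>
    moreover have "(\<lambda>m. 8 * m) ` {m. octal_seq m mod 6 = 3 \<and> (\<Sum>i<m. octal_seq i) mod 3 = 0}
        \<subseteq> {n. \<not> 6 dvd b n}"
      by (auto simp: b_def dvd_eq_mod_eq_0)
    ultimately have "finite ((\<lambda>m. 8 * m)
        ` {m. octal_seq m mod 6 = 3 \<and> (\<Sum>i<m. octal_seq i) mod 3 = 0})"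
      by (rule finite_subset[rotated])
    then have "finite {m. octal_seq m mod 6 = 3 \<and> (\<Sum>i<m. octal_seq i) mod 3 = 0}"
      by (rule finite_imageD) (auto simp: inj_on_def)
    then show False using octal_seq_residues[of 0] by simp
  qed
  ultimately show "almost_all_not_coprime b 6" by (simp add: almost_all_not_coprime_def)
  show "all_residues_infinitely_often K L b 6"
    unfolding all_residues_infinitely_often_def
  proof (intro allI impI ballI)
    fix d a
    assume d: "difference_sequence K L b d" and a: "a \<in> {0..<int 6}"
    have "d n - d (n - 1) = octal_seq (n div 8)" if "n \<ge> 1" for n
      using d that unfolding difference_sequence_iff[OF valid assoc]
      by (simp add: R_def zero_ext_def b_def)
    then show "infinite {n. d n mod int 6 = a}"
      using partial_sums_hit_residues a by simp
  qed
qed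

theorem theorem1:
  "(\<forall>(K :: nat \<Rightarrow> nat) (L :: int list) (R :: int list) (b :: nat \<Rightarrow> int) (h :: nat).
      valid_triple K L R \<and> associated K L R b \<and> admissible_modulus K R h \<longrightarrow>
        (almost_all_divisible b h \<or> almost_all_not_coprime b h \<or>
           all_residues_infinitely_often K L b h) \<and>
        \<not> (almost_all_divisible b h \<and> almost_all_not_coprime b h) \<and>
        \<not> (almost_all_divisible b h \<and> all_residues_infinitely_often K L b h)) \<and>
   (\<exists>(K :: nat \<Rightarrow> nat) (L :: int list) (R :: int list) (b :: nat \<Rightarrow> int) (h :: nat).
      valid_triple K L R \<and> associated K L R b \<and> admissible_modulus K R h \<and>
      almost_all_not_coprime b h \<and> all_residues_infinitely_often K L b h)"
proof (rule conjI)
  show "\<forall>K L R b h. valid_triple K L R \<and> associated K L R b \<and> admissible_modulus K R h \<longrightarrow>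
        (almost_all_divisible b h \<or> almost_all_not_coprime b h \<or>
           all_residues_infinitely_often K L b h) \<and>
        \<not> (almost_all_divisible b h \<and> almost_all_not_coprime b h) \<and>
        \<not> (almost_all_divisible b h \<and> all_residues_infinitely_often K L b h)"
    \<comment> \<open>If (1) and (2) fail, infinitely many values are coprime to \<open>h\<close>,
      whence (3); (2) contains the negation of (1).\<close>
    using coprime_infinitely_often_imp_all_residues almost_all_divisible_imp_not_all_residues
    unfolding almost_all_not_coprime_def admissible_modulus_def by metis
  show "\<exists>K L R b h. valid_triple K L R \<and> associated K L R b \<and> admissible_modulus K R h \<and>
      almost_all_not_coprime b h \<and> all_residues_infinitely_often K L b h"
    using example_both by blast
qed

end
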